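(* Let $d\in\mathbb{N}_0$ and let $L\in\mathbb{R}[\underline X]_{2d+2}^*$ be a linear form with $L(p^2)\ge 0$ for all $p\in\mathbb{R}[\underline X]_{d+1}$. If $L$ is flat, then the modified moment matrix $\widetilde{M_L}$ is a generalized Hankel matrix (of order $d+1$).
   Context: $n\in\mathbb{N}$, $\underline X=(X_1,\dots,X_n)$; $\mathbb{R}[\underline X]_k$ is the space of real polynomials of degree at most $k$, $s_k$ its dimension, and $*$ denotes the dual space. $U_L:=\{p\in\mathbb{R}[\underline X]_{d+1}: L(pq)=0\text{ for all }q\in\mathbb{R}[\underline X]_{d+1}\}$. $L$ is called flat if $\mathbb{R}[\underline X]_{d+1}=\mathbb{R}[\underline X]_d+U_L$; equivalently, the matrices $(L(\underline X^{\alpha+\beta}))_{|\alpha|,|\beta|\le d}$ and $(L(\underline X^{\alpha+\beta}))_{|\alpha|,|\beta|\le d+1}$ have the same rank. Matrices. $M_L:=(L(\underline X^{\alpha+\beta}))_{|\alpha|,|\beta|\le d+1}$, and $M_{L'}:=(L(\underline X^{\alpha+\beta}))_{|\alpha|,|\beta|\le d}$. Let $C_L:=(L(\underline X^{\alpha+\beta}))_{|\alpha|\le d,\ |\beta|=d+1}$. There is a matrix $W_L$ with $M_{L'}W_L=C_L$, and the modified moment matrix $$\widetilde{M_L}:=\begin{pmatrix}M_{L'}&M_{L'}W_L\\ W_L^TM_{L'}&W_L^TM_{L'}W_L\end{pmatrix}$$ does not depend on the choice of $W_L$. A matrix in $\mathbb{R}^{s_{k}\times s_{k}}$, indexed by multi-indices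 of degree at most $k$, is a generalized Hankel matrix of order $k$ if it has the form $(y_{\alpha+\beta})_{|\alpha|,|\beta|\le k}$ for some real family $(y_\gamma)_{|\gamma|\le 2k}$. *)

theory Defs
  imports Complex_Main "HOL-Library.Poly_Mapping"
begin

text \<open>
  The index type \<open>'n\<close> of class \<open>finite\<close> stands for \<open>{1, \<dots>, n}\<close>, so \<open>n = CARD('n) \<ge> 1\<close>.  Multi-indices are
  finitely supported functions \<open>'n \<Rightarrow>\<^sub>0 nat\<close>, and a polynomial maps each multi-index to the
  coefficient of the corresponding monomial; its ring structure is that of \<open>Poly_Mapping\<close>.
\<close>

type_synonym 'n rpoly = "('n \<Rightarrow>\<^sub>0 nat) \<Rightarrow>\<^sub>0 real"

definition mdeg :: "('n::finite \<Rightarrow>\<^sub>0 nat) \<Rightarrow> nat" where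
  "mdeg \<alpha> = (\<Sum>i\<in>UNIV. Poly_Mapping.lookup \<alpha> i)"

definition monom :: "('n \<Rightarrow>\<^sub>0 nat) \<Rightarrow> 'n rpoly" where
  "monom \<alpha> = Poly_Mapping.single \<alpha> 1"

definition polys_upto :: "nat \<Rightarrow> ('n::finite) rpoly set" where
  "polys_upto k = {p. \<forall>\<alpha>\<in>Poly_Mapping.keys p. mdeg \<alpha> \<le> k}"

text \<open>
  An element of the dual of \<open>polys_upto k\<close> is represented by a function on all polynomials;
  its values outside \<open>polys_upto k\<close> are unconstrained.
  The product \<open>Poly_Mapping.single 0 c * p\<close> is the scalar multiple \<open>c p\<close>.
\<close>

definition linear_form_on :: "nat \<Rightarrow> (('n::finite) rpoly \<Rightarrow> real) \<Rightarrow> bool" where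
  "linear_form_on k L \<longleftrightarrow>
     (\<forall>p\<in>polys_upto k. \<forall>q\<in>polys_upto k. L (p + q) = L p + L q) \<and>
     (\<forall>c. \<forall>p\<in>polys_upto k. L (Poly_Mapping.single 0 c * p) = c * L p)"

definition U :: "nat \<Rightarrow> (('n::finite) rpoly \<Rightarrow> real) \<Rightarrow> 'n rpoly set" where
  "U d L = {p \<in> polys_upto (d + 1). \<forall>q\<in>polys_upto (d + 1). L (p * q) = 0}"

definition flat :: "nat \<Rightarrow> (('n::finite) rpoly \<Rightarrow> real) \<Rightarrow> bool" where
  "flat d L \<longleftrightarrow> polys_upto (d + 1) = {p + u | p u. p \<in> polys_upto d \<and> u \<in> U d L}"

text \<open>
  A matrix is a function of its row and column multi-index, of which only the entries at the
  intended indices matter.  The matrices $M_L$, $M_{L'}$ and $C_L$ are therefore all given by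
  \<open>moment_matrix L\<close>, with different ranges of indices.
\<close>

type_synonym 'n mmatrix = "('n \<Rightarrow>\<^sub>0 nat) \<Rightarrow> ('n \<Rightarrow>\<^sub>0 nat) \<Rightarrow> real"

definition moment_matrix :: "('n rpoly \<Rightarrow> real) \<Rightarrow> 'n mmatrix" where
  "moment_matrix L \<alpha> \<beta> = L (monom (\<alpha> + \<beta>))"

definition mmult :: "nat \<Rightarrow> ('n::finite) mmatrix \<Rightarrow> 'n mmatrix \<Rightarrow> 'n mmatrix" where
  "mmult k A B \<alpha> \<beta> = (\<Sum>\<gamma> | mdeg \<gamma> \<le> k. A \<alpha> \<gamma> * B \<gamma> \<beta>)"

definition mtranspose :: "'n mmatrix \<Rightarrow> 'n mmatrix" where
  "mtranspose A \<alpha> \<beta> = A \<beta> \<alpha>"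

text \<open>\<open>solves_W d L W\<close> is $M_{L'} W = C_L$; the rows of \<open>W\<close> are indexed by \<open>mdeg \<alpha> \<le> d\<close> and its
  columns by \<open>mdeg \<beta> = d + 1\<close>.\<close>

definition solves_W :: "nat \<Rightarrow> (('n::finite) rpoly \<Rightarrow> real) \<Rightarrow> 'n mmatrix \<Rightarrow> bool" where
  "solves_W d L W \<longleftrightarrow>
     (\<forall>\<alpha> \<beta>. mdeg \<alpha> \<le> d \<longrightarrow> mdeg \<beta> = d + 1 \<longrightarrow>
        mmult d (moment_matrix L) W \<alpha> \<beta> = moment_matrix L \<alpha> \<beta>)"

definition modified_matrix_of ::
  "nat \<Rightarrow> (('n::finite) rpoly \<Rightarrow> real) \<Rightarrow> 'n mmatrix \<Rightarrow> 'n mmatrix" where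
  "modified_matrix_of d L W \<alpha> \<beta> =
     (let M' = moment_matrix L in
      if mdeg \<alpha> \<le> d then
        (if mdeg \<beta> \<le> d then M' \<alpha> \<beta> else mmult d M' W \<alpha> \<beta>)
      else
        (if mdeg \<beta> \<le> d then mmult d (mtranspose W) M' \<alpha> \<beta>
         else mmult d (mtranspose W) (mmult d M' W) \<alpha> \<beta>))"

text \<open>A solution \<open>W\<close> exists if \<open>L\<close> is nonnegative on squares; by \<open>modified_moment_matrix_eq\<close>
  below the choice is immaterial.\<close>

definition modified_moment_matrix ::
  "nat \<Rightarrow> (('n::finite) rpoly \<Rightarrow> real) \<Rightarrow> 'n mmatrix" where
  "modified_moment_matrix d L = modified_matrix_of d L (SOME W. solves_W d L W)"

definition generalized_hankel :: "nat \<Rightarrow> ('n::finite) mmatrix \<Rightarrow> bool" where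
  "generalized_hankel k A \<longleftrightarrow>
     (\<exists>y :: ('n \<Rightarrow>\<^sub>0 nat) \<Rightarrow> real. \<forall>\<alpha> \<beta>. mdeg \<alpha> \<le> k \<longrightarrow> mdeg \<beta> \<le> k \<longrightarrow> A \<alpha> \<beta> = y (\<alpha> + \<beta>))"

lemma finite_mdeg_le: "finite {\<alpha> :: 'n::finite \<Rightarrow>\<^sub>0 nat. mdeg \<alpha> \<le> k}"
proof -
  have le: "Poly_Mapping.lookup \<alpha> i \<le> mdeg \<alpha>" for \<alpha> :: "'n \<Rightarrow>\<^sub>0 nat" and i
    unfolding mdeg_def by (rule member_le_sum) simp_all
  have "finite {f :: 'n \<Rightarrow> nat. \<forall>i. (i \<in> UNIV \<longrightarrow> f i \<in> {..k}) \<and> (i \<notin> UNIV \<longrightarrow> f i = 0)}"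
    by (rule finite_set_of_finite_funs) simp_all
  moreover have "Poly_Mapping.lookup ` {\<alpha> :: 'n \<Rightarrow>\<^sub>0 nat. mdeg \<alpha> \<le> k} \<subseteq> \<dots>"
    using le order_trans by fastforce
  ultimately have "finite (Poly_Mapping.lookup ` {\<alpha> :: 'n \<Rightarrow>\<^sub>0 nat. mdeg \<alpha> \<le> k})"
    using finite_subset by blast
  then show ?thesis
    by (rule finite_imageD) (simp add: inj_on_def)
qed

lemma modified_matrix_of_eq:
  fixes L :: "('n::finite) rpoly \<Rightarrow> real"
  assumes V: "solves_W d L V" and W: "solves_W d L W"
    and deg: "mdeg \<alpha> \<le> d + 1" "mdeg \<beta> \<le> d + 1"
  shows "modified_matrix_of d L V \<alpha> \<beta> = modified_matrix_of d L W \<alpha> \<beta>"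
proof -
  let ?M = "moment_matrix L"
  have sym: "?M \<gamma> \<delta> = ?M \<delta> \<gamma>" for \<gamma> \<delta>
    by (simp add: moment_matrix_def add.commute)
  have MV: "mmult d ?M V \<gamma> \<delta> = ?M \<gamma> \<delta>" if "mdeg \<gamma> \<le> d" "mdeg \<delta> = d + 1" for \<gamma> \<delta>
    using V that by (simp add: solves_W_def)
  have MW: "mmult d ?M W \<gamma> \<delta> = ?M \<gamma> \<delta>" if "mdeg \<gamma> \<le> d" "mdeg \<delta> = d + 1" for \<gamma> \<delta>
    using W that by (simp add: solves_W_def)
  have tr: "mmult d (mtranspose Z) ?M \<gamma> \<delta> = mmult d ?M Z \<delta> \<gamma>" for Z \<gamma> \<delta>
    by (simp add: mmult_def mtranspose_def sym[of \<delta>] mult.commute)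
  have last: "mmult d (mtranspose V) (mmult d ?M V) \<alpha> \<beta> = mmult d (mtranspose W) (mmult d ?M W) \<alpha> \<beta>"
    if a: "mdeg \<alpha> = d + 1" and b: "mdeg \<beta> = d + 1"
  proof -
    have "mmult d (mtranspose V) (mmult d ?M V) \<alpha> \<beta> = (\<Sum>\<gamma> | mdeg \<gamma> \<le> d. V \<gamma> \<alpha> * mmult d ?M W \<gamma> \<beta>)"
      unfolding mmult_def[of _ "mtranspose V"] mtranspose_def
      by (rule sum.cong) (auto simp: MV MW b)
    also have "\<dots> = (\<Sum>\<gamma> | mdeg \<gamma> \<le> d. \<Sum>\<delta> | mdeg \<delta> \<le> d. V \<gamma> \<alpha> * (?M \<gamma> \<delta> * W \<delta> \<beta>))"
      by (simp add: mmult_def sum_distrib_left)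
    also have "\<dots> = (\<Sum>\<delta> | mdeg \<delta> \<le> d. \<Sum>\<gamma> | mdeg \<gamma> \<le> d. V \<gamma> \<alpha> * (?M \<gamma> \<delta> * W \<delta> \<beta>))"
      by (rule sum.swap)
    also have "\<dots> = (\<Sum>\<delta> | mdeg \<delta> \<le> d. W \<delta> \<beta> * mmult d ?M V \<delta> \<alpha>)"
      unfolding mmult_def sum_distrib_left
      by (intro sum.cong refl) (simp add: sym mult_ac)
    also have "\<dots> = (\<Sum>\<delta> | mdeg \<delta> \<le> d. W \<delta> \<beta> * mmult d ?M W \<delta> \<alpha>)"
      by (rule sum.cong) (auto simp: MV MW a)
    also have "\<dots> = (\<Sum>\<delta> | mdeg \<delta> \<le> d. \<Sum>\<gamma> | mdeg \<gamma> \<le> d. W \<gamma> \<alpha> * (?M \<gamma> \<delta> * W \<delta> \<beta>))"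
      unfolding mmult_def sum_distrib_left
      by (intro sum.cong refl) (simp add: sym mult_ac)
    also have "\<dots> = (\<Sum>\<gamma> | mdeg \<gamma> \<le> d. \<Sum>\<delta> | mdeg \<delta> \<le> d. W \<gamma> \<alpha> * (?M \<gamma> \<delta> * W \<delta> \<beta>))"
      by (rule sum.swap)
    also have "\<dots> = mmult d (mtranspose W) (mmult d ?M W) \<alpha> \<beta>"
      by (simp add: mmult_def mtranspose_def sum_distrib_left)
    finally show ?thesis .
  qed
  show ?thesis
    using deg last by (auto simp: modified_matrix_of_def Let_def tr MV MW le_Suc_eq)
qed

lemma modified_moment_matrix_eq:
  assumes "solves_W d L W" "mdeg \<alpha> \<le> d + 1" "mdeg \<beta> \<le> d + 1"
  shows "modified_moment_matrix d L \<alpha> \<beta> = modified_matrix_of d L W \<alpha> \<beta>"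
  unfolding modified_moment_matrix_def
  by (rule modified_matrix_of_eq[OF someI[of "solves_W d L", OF assms(1)] assms])

end

theory Submission
  imports Defs
begin

text \<open>
  Flatness rewrites every monomial \<open>X\<^sup>\<beta>\<close> of top degree \<open>d + 1\<close> as a polynomial \<open>p\<^sub>\<beta>\<close> of degree at
  most \<open>d\<close> modulo \<open>U d L\<close>, and \<open>L\<close> cannot tell \<open>X\<^sup>\<beta>\<close> from \<open>p\<^sub>\<beta>\<close> after multiplication by any
  polynomial of degree at most \<open>d + 1\<close>.  Let \<open>W\<close> have the coefficients of \<open>p\<^sub>\<beta>\<close> in its column
  \<open>\<beta>\<close>.  Then $(M_{L'} W)_{\alpha\beta} = L(X^\alpha p_\beta) = L(X^{\alpha+\beta})$, so \<open>W\<close> is an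
  admissible choice in the definition of the modified moment matrix.  Carrying out the same
  replacement in the rows, $(W^T M_{L'} W)_{\alpha\beta} = L(p_\alpha X^\beta) = L(X^{\alpha+\beta})$.
  Hence the modified moment matrix of a flat \<open>L\<close> is the full moment matrix, which is Hankel by
  its very form.
\<close>

lemma finite_poly_mapping_sum_single:
  fixes p :: "'a \<Rightarrow>\<^sub>0 'b::comm_monoid_add"
  assumes "finite A" "Poly_Mapping.keys p \<subseteq> A"
  shows "p = (\<Sum>\<gamma>\<in>A. Poly_Mapping.single \<gamma> (Poly_Mapping.lookup p \<gamma>))"
proof (rule poly_mapping_eqI)
  fix \<delta>
  have "Poly_Mapping.lookup p \<delta> = (if \<delta> \<in> A then Poly_Mapping.lookup p \<delta> else 0)"
    using assms(2) by (auto simp: in_keys_iff)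
  also have "\<dots> = (\<Sum>\<gamma>\<in>A. Poly_Mapping.lookup p \<gamma> when \<gamma> = \<delta>)"
    using assms(1) by (simp add: when_def)
  finally show "Poly_Mapping.lookup p \<delta> =
      Poly_Mapping.lookup (\<Sum>\<gamma>\<in>A. Poly_Mapping.single \<gamma> (Poly_Mapping.lookup p \<gamma>)) \<delta>"
    by (simp add: lookup_sum lookup_single)
qed

lemma mdeg_add: "mdeg (\<alpha> + \<beta>) = mdeg \<alpha> + mdeg \<beta>"
  by (simp add: mdeg_def lookup_add sum.distrib)

lemma monom_mult: "monom \<alpha> * monom \<beta> = monom (\<alpha> + \<beta>)"
  by (simp add: monom_def mult_single)

lemma monom_in_polys_upto: "mdeg \<alpha> \<le> k \<Longrightarrow> monom \<alpha> \<in> polys_upto k"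
  by (simp add: monom_def polys_upto_def)

lemma zero_in_polys_upto: "0 \<in> polys_upto k"
  by (simp add: polys_upto_def)

lemma polys_upto_add: "p \<in> polys_upto k \<Longrightarrow> q \<in> polys_upto k \<Longrightarrow> p + q \<in> polys_upto k"
  using Poly_Mapping.keys_add[of p q] by (auto simp: polys_upto_def)

lemma polys_upto_mult:
  assumes "p \<in> polys_upto k" "q \<in> polys_upto l"
  shows "p * q \<in> polys_upto (k + l)"
  using keys_mult[of p q] assms by (fastforce simp: polys_upto_def mdeg_add intro: add_mono)

lemma polys_upto_mono: "p \<in> polys_upto k \<Longrightarrow> k \<le> l \<Longrightarrow> p \<in> polys_upto l"
  by (auto simp: polys_upto_def)

lemma polys_upto_sum: "(\<And>i. i \<in> A \<Longrightarrow> f i \<in> polys_upto k) \<Longrightarrow> sum f A \<in> polys_upto k"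
  by (induction A rule: infinite_finite_induct) (auto simp: zero_in_polys_upto polys_upto_add)

lemma linear_form_on_add:
  "linear_form_on k L \<Longrightarrow> p \<in> polys_upto k \<Longrightarrow> q \<in> polys_upto k \<Longrightarrow> L (p + q) = L p + L q"
  by (simp add: linear_form_on_def)

lemma linear_form_on_scale:
  "linear_form_on k L \<Longrightarrow> p \<in> polys_upto k \<Longrightarrow> L (Poly_Mapping.single 0 c * p) = c * L p"
  by (simp add: linear_form_on_def)

lemma linear_form_on_zero: "linear_form_on k L \<Longrightarrow> L 0 = 0"
  using linear_form_on_scale[OF _ zero_in_polys_upto, of k L 0] by simp

lemma linear_form_on_sum:
  assumes L: "linear_form_on k L" and "\<And>i. i \<in> A \<Longrightarrow> f i \<in> polys_upto k"
  shows "L (sum f A) = (\<Sum>i\<in>A. L (f i))"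
  using assms(2)
  by (induction A rule: infinite_finite_induct)
    (auto simp: linear_form_on_zero[OF L] linear_form_on_add[OF L] polys_upto_sum)

text \<open>Evaluating \<open>L\<close> on a multiple of a monomial is a matrix-vector product with the moment matrix;
  this is what turns the matrix identities into statements about polynomials.\<close>

lemma linear_form_on_monom_mult:
  assumes L: "linear_form_on k L" and p: "p \<in> polys_upto m" and deg: "mdeg \<alpha> + m \<le> k"
  shows "L (monom \<alpha> * p) = (\<Sum>\<gamma> | mdeg \<gamma> \<le> m. moment_matrix L \<alpha> \<gamma> * Poly_Mapping.lookup p \<gamma>)"
proof -
  let ?c = "Poly_Mapping.lookup p"
  have "p = (\<Sum>\<gamma> | mdeg \<gamma> \<le> m. Poly_Mapping.single \<gamma> (?c \<gamma>))"
    using p by (intro finite_poly_mapping_sum_single finite_mdeg_le) (auto simp: polys_upto_def)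
  then have "monom \<alpha> * p = (\<Sum>\<gamma> | mdeg \<gamma> \<le> m. monom \<alpha> * Poly_Mapping.single \<gamma> (?c \<gamma>))"
    by (metis sum_distrib_left)
  also have "\<dots> = (\<Sum>\<gamma> | mdeg \<gamma> \<le> m. Poly_Mapping.single 0 (?c \<gamma>) * monom (\<alpha> + \<gamma>))"
    by (simp add: monom_def mult_single)
  also have "L \<dots> = (\<Sum>\<gamma> | mdeg \<gamma> \<le> m. L (Poly_Mapping.single 0 (?c \<gamma>) * monom (\<alpha> + \<gamma>)))"
  proof (rule linear_form_on_sum[OF L])
    fix \<gamma> :: "'a \<Rightarrow>\<^sub>0 nat" assume "\<gamma> \<in> {\<gamma>. mdeg \<gamma> \<le> m}"
    then show "Poly_Mapping.single 0 (?c \<gamma>) * monom (\<alpha> + \<gamma>) \<in> polys_upto k"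
      using deg by (simp add: monom_def mult_single polys_upto_def mdeg_add)
  qed
  also have "\<dots> = (\<Sum>\<gamma> | mdeg \<gamma> \<le> m. moment_matrix L \<alpha> \<gamma> * ?c \<gamma>)"
    using deg
    by (intro sum.cong refl)
      (simp add: moment_matrix_def linear_form_on_scale[OF L] monom_in_polys_upto mdeg_add)
  finally show ?thesis .
qed

text \<open>In a flat decomposition \<open>X\<^sup>\<beta> = p + u\<close> the part \<open>u\<close> is orthogonal to all polynomials of degree
  at most \<open>d + 1\<close>, not only to those of degree at most \<open>d\<close>.\<close>

lemma flat_monom_reduction:
  assumes L: "linear_form_on (2 * d + 2) L" and "flat d L" and \<beta>: "mdeg \<beta> \<le> d + 1"
  shows "\<exists>p\<in>polys_upto d. \<forall>\<alpha>. mdeg \<alpha> \<le> d + 1 \<longrightarrow> L (monom \<alpha> * p) = L (monom (\<alpha> + \<beta>))"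
proof -
  obtain p u where p: "p \<in> polys_upto d" and u: "u \<in> U d L" and \<beta>_eq: "monom \<beta> = p + u"
    using \<open>flat d L\<close> monom_in_polys_upto[OF \<beta>] by (auto simp: flat_def)
  have "L (monom (\<alpha> + \<beta>)) = L (monom \<alpha> * p)" if "mdeg \<alpha> \<le> d + 1" for \<alpha>
  proof -
    have \<alpha>: "monom \<alpha> \<in> polys_upto (d + 1)"
      using that by (rule monom_in_polys_upto)
    have deg: "monom \<alpha> * q \<in> polys_upto (2 * d + 2)" if "q \<in> polys_upto (d + 1)" for q
      using polys_upto_mult[OF \<alpha> that] by (rule polys_upto_mono) simp
    have "L (monom (\<alpha> + \<beta>)) = L (monom \<alpha> * p + monom \<alpha> * u)"
      by (simp flip: monom_mult add: \<beta>_eq distrib_left)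
    also have "\<dots> = L (monom \<alpha> * p) + L (monom \<alpha> * u)"
      using p u polys_upto_mono[of p d "d + 1"]
      by (intro linear_form_on_add[OF L] deg) (auto simp: U_def)
    also have "L (monom \<alpha> * u) = 0"
      using u \<alpha> by (auto simp: U_def mult.commute[of "monom \<alpha>"])
    finally show ?thesis by simp
  qed
  with p show ?thesis by auto
qed

text \<open>The matrix \<open>W\<close> of coefficients of the reduced monomials.  The range \<open>mdeg \<alpha> \<le> d + 1\<close> is one
  degree more than \<open>solves_W\<close> asks for; flatness provides this extra degree, and it is what
  identifies the lower right block.\<close>

lemma flat_obtains_extension:
  assumes L: "linear_form_on (2 * d + 2) L" and "flat d L"
  obtains W where "\<And>\<alpha> \<beta>. mdeg \<alpha> \<le> d + 1 \<Longrightarrow> mdeg \<beta> \<le> d + 1 \<Longrightarrow>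
    mmult d (moment_matrix L) W \<alpha> \<beta> = moment_matrix L \<alpha> \<beta>"
proof -
  have "\<forall>\<beta>. \<exists>p. mdeg \<beta> \<le> d + 1 \<longrightarrow> p \<in> polys_upto d \<and>
      (\<forall>\<alpha>. mdeg \<alpha> \<le> d + 1 \<longrightarrow> L (monom \<alpha> * p) = L (monom (\<alpha> + \<beta>)))"
    using flat_monom_reduction[OF assms] by blast
  then obtain P where P: "\<And>\<beta>. mdeg \<beta> \<le> d + 1 \<Longrightarrow> P \<beta> \<in> polys_upto d"
    "\<And>\<alpha> \<beta>. mdeg \<beta> \<le> d + 1 \<Longrightarrow> mdeg \<alpha> \<le> d + 1 \<Longrightarrow> L (monom \<alpha> * P \<beta>) = L (monom (\<alpha> + \<beta>))"
    by metis
  show ?thesis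
  proof (rule that)
    fix \<alpha> \<beta> :: "'a \<Rightarrow>\<^sub>0 nat" assume \<alpha>: "mdeg \<alpha> \<le> d + 1" and \<beta>: "mdeg \<beta> \<le> d + 1"
    show "mmult d (moment_matrix L) (\<lambda>\<gamma> \<beta>. Poly_Mapping.lookup (P \<beta>) \<gamma>) \<alpha> \<beta> = moment_matrix L \<alpha> \<beta>"
      using linear_form_on_monom_mult[OF L P(1)[OF \<beta>], of \<alpha>] P(2)[OF \<beta> \<alpha>] \<alpha>
      by (simp add: mmult_def moment_matrix_def)
  qed
qed

theorem flat_modified_moment_matrix_eq:
  fixes L :: "('n::finite) rpoly \<Rightarrow> real"
  assumes L: "linear_form_on (2 * d + 2) L" and flat: "flat d L"
    and \<alpha>: "mdeg \<alpha> \<le> d + 1" and \<beta>: "mdeg \<beta> \<le> d + 1"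
  shows "modified_moment_matrix d L \<alpha> \<beta> = moment_matrix L \<alpha> \<beta>"
proof -
  let ?M = "moment_matrix L"
  obtain W where W: "\<And>\<alpha> \<beta>. mdeg \<alpha> \<le> d + 1 \<Longrightarrow> mdeg \<beta> \<le> d + 1 \<Longrightarrow> mmult d ?M W \<alpha> \<beta> = ?M \<alpha> \<beta>"
    using flat_obtains_extension[OF L flat] by blast
  have sym: "?M \<gamma> \<delta> = ?M \<delta> \<gamma>" for \<gamma> \<delta>
    by (simp add: moment_matrix_def add.commute)
  have WtM: "mmult d (mtranspose W) ?M \<alpha> \<beta> = ?M \<alpha> \<beta>"
    using W[OF \<beta> \<alpha>] by (simp add: mmult_def mtranspose_def sym[of \<beta>] mult.commute)
  have WtMW: "mmult d (mtranspose W) (mmult d ?M W) \<alpha> \<beta> = ?M \<alpha> \<beta>"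
  proof -
    have "mmult d (mtranspose W) (mmult d ?M W) \<alpha> \<beta> = mmult d (mtranspose W) ?M \<alpha> \<beta>"
      unfolding mmult_def[of d "mtranspose W"] using \<beta>
      by (intro sum.cong refl arg_cong[where f = "(*) _"] W) auto
    then show ?thesis by (simp add: WtM)
  qed
  have "solves_W d L W"
    by (simp add: solves_W_def W)
  then have "modified_moment_matrix d L \<alpha> \<beta> = modified_matrix_of d L W \<alpha> \<beta>"
    using \<alpha> \<beta> by (rule modified_moment_matrix_eq)
  also have "\<dots> = ?M \<alpha> \<beta>"
    using W[OF \<alpha> \<beta>] by (simp add: modified_matrix_of_def Let_def WtM WtMW)
  finally show ?thesis .
qed

theorem corollary6p3:
  fixes d :: nat and L :: "('n::finite) rpoly \<Rightarrow> real"
  assumes "linear_form_on (2 * d + 2) L"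
    and "\<And>p. p \<in> polys_upto (d + 1) \<Longrightarrow> L (p\<^sup>2) \<ge> 0"
    and "flat d L"
  shows "generalized_hankel (d + 1) (modified_moment_matrix d L)"
  unfolding generalized_hankel_def
proof (intro exI allI impI)
  fix \<alpha> \<beta> :: "'n \<Rightarrow>\<^sub>0 nat" assume "mdeg \<alpha> \<le> d + 1" "mdeg \<beta> \<le> d + 1"
  then show "modified_moment_matrix d L \<alpha> \<beta> = (\<lambda>\<gamma>. L (monom \<gamma>)) (\<alpha> + \<beta>)"
    using flat_modified_moment_matrix_eq[OF assms(1,3)] by (simp add: moment_matrix_def)
qed

end
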